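(* Let $X$ be a Tychonoff space, let $\lambda$ be a bornology on $X$ with a closed base, and let $(Y,\rho)$ be a metric space. If $X$ is functionally generated with respect to $Y$ by the family $\sigma\lambda$, then the space $C_{\lambda,\rho}(X,Y)$ is Dieudonné complete.
   Context: A bornology on $X$ is a family $\lambda$ of nonempty subsets of $X$ that covers $X$, is closed under finite unions, and is closed under taking nonempty subsets. A base of $\lambda$ is a subfamily $\lambda'\subseteq\lambda$ such that each $A\in\lambda$ is contained in some $B\in\lambda'$; a base is closed if all its members are closed subsets of $X$. $\sigma\lambda$ denotes the family of all countable unions of elements of $\lambda$. For a family $\mathcal{F}$ of subsets of $X$ and a topological space $Y$, the space $X$ is functionally generated by $\mathcal{F}$ with respect to $Y$ if for every discontinuous function $f:X\to Y$ there is $A\in\mathcal{F}$ such that $f|_A$ cannot be extended to a continuous function from all of $X$ to $Y$. $C_{\lambda,\rho}(X,Y)$ is the set $C(X,Y)$ of all continuous functions $X\to Y$ with the topology of uniform convergence on elements of $\lambda$, i.e. the topology generated by the uniformity with basic entourages $\{(f,g)\in C(X,Y)^2: \rho(f(x),g(x))<\epsilon \text{ for all } x\in A\}$, $A\in\lambda$, $\epsilon>0$. A Tychonoff space is Dieudonné complete if it is complete with respect to the maximal (finest) uniformity compatible with its topology. *)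

theory Defs
  imports "HOL-Analysis.Analysis"
begin

section \<open>Uniformities on a set\<close>

text \<open>
  The type class \<open>uniform_space\<close> fixes the underlying set to be a whole type and one
  uniformity per type. The following is its relativisation to a carrier set: as there, a
  uniformity is a filter on pairs, \<open>eventually E U\<close> says that \<open>E\<close> is an entourage, and
  \<open>U \<le> V\<close> says that \<open>U\<close> is finer than \<open>V\<close>.
\<close>

definition uniform_structure_on :: "'a set \<Rightarrow> ('a \<times> 'a) filter \<Rightarrow> bool" where
  "uniform_structure_on S U \<longleftrightarrow>
     U \<le> principal (S \<times> S) \<and>
     (\<forall>E. eventually E U \<longrightarrow> (\<forall>x\<in>S. E (x, x))) \<and>
     (\<forall>E. eventually E U \<longrightarrow> eventually (\<lambda>(x, y). E (y, x)) U) \<and>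
     (\<forall>E. eventually E U \<longrightarrow>
        (\<exists>D. eventually D U \<and> (\<forall>x\<in>S. \<forall>y\<in>S. \<forall>z\<in>S. D (x, y) \<longrightarrow> D (y, z) \<longrightarrow> E (x, z))))"

definition uniform_topology :: "'a set \<Rightarrow> ('a \<times> 'a) filter \<Rightarrow> 'a topology" where
  "uniform_topology S U =
     topology (\<lambda>W. W \<subseteq> S \<and> (\<forall>x\<in>W. eventually (\<lambda>(x', y). x' = x \<longrightarrow> y \<in> W) U))"

lemma openin_uniform_topology:
  "openin (uniform_topology S U) W \<longleftrightarrow>
     W \<subseteq> S \<and> (\<forall>x\<in>W. eventually (\<lambda>(x', y). x' = x \<longrightarrow> y \<in> W) U)"
proof -
  have "istopology (\<lambda>W. W \<subseteq> S \<and> (\<forall>x\<in>W. eventually (\<lambda>(x', y). x' = x \<longrightarrow> y \<in> W) U))"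
    unfolding istopology_def
  proof (intro conjI allI impI ballI)
    fix V W x
    assume "V \<subseteq> S \<and> (\<forall>x\<in>V. eventually (\<lambda>(x', y). x' = x \<longrightarrow> y \<in> V) U)"
      "W \<subseteq> S \<and> (\<forall>x\<in>W. eventually (\<lambda>(x', y). x' = x \<longrightarrow> y \<in> W) U)" "x \<in> V \<inter> W"
    then have "eventually (\<lambda>(x', y). x' = x \<longrightarrow> y \<in> V) U"
      "eventually (\<lambda>(x', y). x' = x \<longrightarrow> y \<in> W) U"
      by auto
    then show "eventually (\<lambda>(x', y). x' = x \<longrightarrow> y \<in> V \<inter> W) U"
      by eventually_elim auto
  next
    fix \<W> x
    assume *: "\<forall>W\<in>\<W>. W \<subseteq> S \<and> (\<forall>x\<in>W. eventually (\<lambda>(x', y). x' = x \<longrightarrow> y \<in> W) U)"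
      and "x \<in> \<Union>\<W>"
    then obtain W where W: "W \<in> \<W>" "x \<in> W" by blast
    with * have "eventually (\<lambda>(x', y). x' = x \<longrightarrow> y \<in> W) U" by blast
    then show "eventually (\<lambda>(x', y). x' = x \<longrightarrow> y \<in> \<Union>\<W>) U"
      by eventually_elim (use W in auto)
  qed auto
  then show ?thesis
    by (simp add: uniform_topology_def topology_inverse')
qed

lemma topspace_uniform_topology:
  assumes "uniform_structure_on S U"
  shows "topspace (uniform_topology S U) = S"
proof -
  have "eventually (\<lambda>p. p \<in> S \<times> S) U"
    using assms by (simp add: uniform_structure_on_def le_principal)
  then have "\<forall>x\<in>S. eventually (\<lambda>(x', y). x' = x \<longrightarrow> y \<in> S) U"
    by (auto elim: eventually_mono)
  then have "openin (uniform_topology S U) S"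
    by (simp add: openin_uniform_topology)
  then show ?thesis
    by (metis openin_subset openin_topspace openin_uniform_topology subset_antisym)
qed

definition complete_structure_on :: "'a set \<Rightarrow> ('a \<times> 'a) filter \<Rightarrow> bool" where
  "complete_structure_on S U \<longleftrightarrow>
     (\<forall>F. F \<noteq> bot \<and> F \<le> principal S \<and> F \<times>\<^sub>F F \<le> U \<longrightarrow>
        (\<exists>x\<in>S. limitin (uniform_topology S U) (\<lambda>y. y) x F))"

definition compatible_uniformity :: "'a topology \<Rightarrow> ('a \<times> 'a) filter \<Rightarrow> bool" where
  "compatible_uniformity T U \<longleftrightarrow>
     uniform_structure_on (topspace T) U \<and> uniform_topology (topspace T) U = T"

definition finest_uniformity :: "'a topology \<Rightarrow> ('a \<times> 'a) filter \<Rightarrow> bool" where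
  "finest_uniformity T U \<longleftrightarrow>
     compatible_uniformity T U \<and> (\<forall>V. compatible_uniformity T V \<longrightarrow> U \<le> V)"

definition tychonoff_space :: "'a topology \<Rightarrow> bool" where
  "tychonoff_space T \<longleftrightarrow> completely_regular_space T \<and> Hausdorff_space T"

text \<open>
  A Tychonoff space always has a finest compatible uniformity, and it is unique by antisymmetry
  of \<open>\<le>\<close>; the existential quantifier below just names it.
\<close>

definition Dieudonne_complete :: "'a topology \<Rightarrow> bool" where
  "Dieudonne_complete T \<longleftrightarrow>
     tychonoff_space T \<and>
     (\<exists>U. finest_uniformity T U \<and> complete_structure_on (topspace T) U)"


section \<open>Bornologies\<close>

definition bornology :: "'a set \<Rightarrow> 'a set set \<Rightarrow> bool" where
  "bornology X \<L> \<longleftrightarrow>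
     (\<forall>A\<in>\<L>. A \<noteq> {} \<and> A \<subseteq> X) \<and>
     \<Union>\<L> = X \<and>
     (\<forall>A\<in>\<L>. \<forall>B\<in>\<L>. A \<union> B \<in> \<L>) \<and>
     (\<forall>A\<in>\<L>. \<forall>B. B \<noteq> {} \<and> B \<subseteq> A \<longrightarrow> B \<in> \<L>)"

definition bornology_base :: "'a set set \<Rightarrow> 'a set set \<Rightarrow> bool" where
  "bornology_base \<L> \<B> \<longleftrightarrow> \<B> \<subseteq> \<L> \<and> (\<forall>A\<in>\<L>. \<exists>B\<in>\<B>. A \<subseteq> B)"

definition countable_unions :: "'a set set \<Rightarrow> 'a set set" where
  "countable_unions \<L> = {\<Union>\<A> |\<A>. \<A> \<subseteq> \<L> \<and> \<A> \<noteq> {} \<and> countable \<A>}"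

definition functionally_generated :: "'a topology \<Rightarrow> 'a set set \<Rightarrow> 'b topology \<Rightarrow> bool" where
  "functionally_generated X \<F> Y \<longleftrightarrow>
     (\<forall>f \<in> topspace X \<rightarrow> topspace Y. \<not> continuous_map X Y f \<longrightarrow>
        (\<exists>A\<in>\<F>. \<not> (\<exists>g. continuous_map X Y g \<and> (\<forall>x\<in>A. g x = f x))))"


section \<open>Spaces of continuous functions\<close>

text \<open>
  Extensionality makes elements of the function space correspond exactly to continuous
  functions on \<open>topspace X\<close>.
\<close>

definition cfuns :: "'a topology \<Rightarrow> 'b topology \<Rightarrow> ('a \<Rightarrow> 'b) set" where
  "cfuns X Y = {f \<in> extensional (topspace X). continuous_map X Y f}"

text \<open>
  The leading \<open>principal\<close> restricts to the carrier and supplies the whole-space entourage when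
  \<open>\<L>\<close> is empty, which for a bornology happens only if the underlying set is empty.
\<close>

definition cfun_uniformity ::
    "'a topology \<Rightarrow> 'a set set \<Rightarrow> 'b metric \<Rightarrow> (('a \<Rightarrow> 'b) \<times> ('a \<Rightarrow> 'b)) filter" where
  "cfun_uniformity X \<L> m =
     (let C = cfuns X (mtopology_of m) in
      inf (principal (C \<times> C))
        (INF (A, \<epsilon>) \<in> \<L> \<times> {0<..}.
           principal {(f, g) \<in> C \<times> C. \<forall>x\<in>A. mdist m (f x) (g x) < \<epsilon>}))"

definition cfun_topology ::
    "'a topology \<Rightarrow> 'a set set \<Rightarrow> 'b metric \<Rightarrow> ('a \<Rightarrow> 'b) topology" where
  "cfun_topology X \<L> m =
     uniform_topology (cfuns X (mtopology_of m)) (cfun_uniformity X \<L> m)"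

lemma eventually_cfun_uniformity:
  fixes m :: "'b metric"
  assumes "bornology (topspace X) \<L>" "\<L> \<noteq> {}"
  defines "C \<equiv> cfuns X (mtopology_of m)"
  shows "eventually E (cfun_uniformity X \<L> m) \<longleftrightarrow>
     (\<exists>A\<in>\<L>. \<exists>\<epsilon>>0. \<forall>f\<in>C. \<forall>g\<in>C. (\<forall>x\<in>A. mdist m (f x) (g x) < \<epsilon>) \<longrightarrow> E (f, g))"
proof -
  let ?N = "\<lambda>(A, \<epsilon>). {(f, g) \<in> C \<times> C. \<forall>x\<in>A. mdist m (f x) (g x) < \<epsilon>}"
  let ?I = "\<L> \<times> {0::real<..}"
  let ?F = "INF p \<in> ?I. principal (?N p)"
  have ne: "?I \<noteq> {}"
    using assms(2) greaterThan_non_empty by blast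
  then obtain q where "q \<in> ?I" by blast
  then have "?F \<le> principal (C \<times> C)"
    by (intro INF_lower2[of q]) auto
  then have "cfun_uniformity X \<L> m = ?F"
    unfolding cfun_uniformity_def Let_def C_def[symmetric]
    by (simp add: inf_absorb2 case_prod_unfold)
  moreover have "eventually E ?F \<longleftrightarrow> (\<exists>p\<in>?I. eventually E (principal (?N p)))"
  proof (rule eventually_INF_base[OF ne])
    fix p q
    assume pq: "p \<in> ?I" "q \<in> ?I"
    obtain A \<epsilon> B \<delta> where p: "p = (A, \<epsilon>)" and q: "q = (B, \<delta>)"
      by (metis surj_pair)
    have "\<forall>A\<in>\<L>. \<forall>B\<in>\<L>. A \<union> B \<in> \<L>"
      using assms(1) unfolding bornology_def by blast
    then have "(A \<union> B, min \<epsilon> \<delta>) \<in> ?I"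
      using pq p q by simp
    moreover have "?N (A \<union> B, min \<epsilon> \<delta>) \<subseteq> ?N p \<inter> ?N q"
      by (auto simp: p q)
    ultimately show "\<exists>r\<in>?I. principal (?N r) \<le> inf (principal (?N p)) (principal (?N q))"
      by (metis (lifting) inf_principal principal_le_iff)
  qed
  ultimately show ?thesis
    unfolding eventually_principal by (force simp: Bex_def)
qed

lemma uniform_structure_on_cfun_uniformity:
  assumes "bornology (topspace X) \<L>"
  shows "uniform_structure_on (cfuns X (mtopology_of m)) (cfun_uniformity X \<L> m)"
proof (cases "\<L> = {}")
  case True
  then have "topspace X = {}"
    using assms unfolding bornology_def by blast
  then have "f = g" if "f \<in> cfuns X (mtopology_of m)" "g \<in> cfuns X (mtopology_of m)" for f g
    using that by (auto simp: cfuns_def extensional_def)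
  with True show ?thesis
    unfolding uniform_structure_on_def cfun_uniformity_def Let_def
    by (auto simp: eventually_principal split_beta)
next
  case False
  let ?C = "cfuns X (mtopology_of m)" and ?U = "cfun_uniformity X \<L> m"
  note ev = eventually_cfun_uniformity[OF assms False, where m = m]
  have mem: "f x \<in> mspace m" if "f \<in> ?C" "A \<in> \<L>" "x \<in> A" for f A x
  proof -
    have "x \<in> topspace X"
      using that assms unfolding bornology_def by blast
    then show ?thesis
      using that by (auto simp: cfuns_def continuous_map_def)
  qed
  show ?thesis
    unfolding uniform_structure_on_def
  proof (intro conjI allI impI ballI)
    show "?U \<le> principal (?C \<times> ?C)"
      by (simp add: cfun_uniformity_def Let_def)
  next
    fix E f assume "eventually E ?U" "f \<in> ?C"
    then show "E (f, f)"
      unfolding ev by (metis mdist_zero mem)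
  next
    fix E assume "eventually E ?U"
    then obtain A \<epsilon> where A: "A \<in> \<L>" "\<epsilon> > 0"
      and E: "\<And>f g. f \<in> ?C \<Longrightarrow> g \<in> ?C \<Longrightarrow> \<forall>x\<in>A. mdist m (f x) (g x) < \<epsilon> \<Longrightarrow> E (f, g)"
      unfolding ev by blast
    have "E (g, f)" if "f \<in> ?C" "g \<in> ?C" "\<forall>x\<in>A. mdist m (f x) (g x) < \<epsilon>" for f g
      using E[OF that(2,1)] that(3) by (simp add: mdist_commute[of m "g _"])
    then show "eventually (\<lambda>(x, y). E (y, x)) ?U"
      unfolding ev using A by (intro bexI[of _ A] exI[of _ \<epsilon>]) auto
  next
    fix E assume "eventually E ?U"
    then obtain A \<epsilon> where A: "A \<in> \<L>" "\<epsilon> > 0"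
      and E: "\<And>f g. f \<in> ?C \<Longrightarrow> g \<in> ?C \<Longrightarrow> \<forall>x\<in>A. mdist m (f x) (g x) < \<epsilon> \<Longrightarrow> E (f, g)"
      unfolding ev by blast
    define D where "D = (\<lambda>(f, g). \<forall>x\<in>A. mdist m (f x) (g x) < \<epsilon> / 2)"
    have "eventually D ?U"
      unfolding ev D_def using A by (intro bexI[of _ A] exI[of _ "\<epsilon> / 2"]) auto
    moreover have "E (f, h)"
      if fgh: "f \<in> ?C" "g \<in> ?C" "h \<in> ?C" and D: "D (f, g)" "D (g, h)" for f g h
    proof (rule E[OF fgh(1,3)], rule ballI)
      fix x assume x: "x \<in> A"
      have "mdist m (f x) (h x) \<le> mdist m (f x) (g x) + mdist m (g x) (h x)"
        by (intro mdist_triangle mem[OF _ A(1) x] fgh)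
      also have "\<dots> < \<epsilon> / 2 + \<epsilon> / 2"
        using D x unfolding D_def by (intro add_strict_mono) auto
      finally show "mdist m (f x) (h x) < \<epsilon>" by simp
    qed
    ultimately show "\<exists>D. eventually D ?U \<and>
        (\<forall>x\<in>?C. \<forall>y\<in>?C. \<forall>z\<in>?C. D (x, y) \<longrightarrow> D (y, z) \<longrightarrow> E (x, z))"
      by blast
  qed
qed

end

theory Submission
  imports Defs
begin

text \<open>
  Every continuous pseudometric is uniformly continuous for the finest uniformity, so a Cauchy
  filter \<open>F\<close> is Cauchy for each of them. For a countable union \<open>A\<close> of members of \<open>\<L>\<close> there is one
  continuous pseudometric on the function space that controls pointwise convergence on \<open>A\<close>, and
  \<open>F\<close> converges for it to some continuous function. Hence the pointwise limit of \<open>F\<close> agrees on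
  \<open>A\<close> with a continuous function, so it is continuous by functional generation; as \<open>F\<close> is
  uniformly Cauchy on the members of \<open>\<L>\<close>, it converges there uniformly.
\<close>

section \<open>The finest uniformity\<close>

lemma uniform_structure_onD:
  assumes "uniform_structure_on S U"
  shows "U \<le> principal (S \<times> S)"
    and "eventually E U \<Longrightarrow> x \<in> S \<Longrightarrow> E (x, x)"
    and "eventually E U \<Longrightarrow> eventually (\<lambda>(x, y). E (y, x)) U"
    and "eventually E U \<Longrightarrow>
           \<exists>D. eventually D U \<and> (\<forall>x\<in>S. \<forall>y\<in>S. \<forall>z\<in>S. D (x, y) \<longrightarrow> D (y, z) \<longrightarrow> E (x, z))"
  using assms unfolding uniform_structure_on_def by blast+

text \<open>The set \<open>G\<close> of points that have \<open>W\<close> as an entourage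
  neighbourhood plays the interior of \<open>W\<close>. Reflexivity puts \<open>G\<close> inside
  \<open>W\<close>, and the composition axiom makes \<open>G\<close> open.\<close>

lemma uniform_topology_neighbourhood:
  assumes "uniform_structure_on S V" "x \<in> S"
    and ev: "eventually (\<lambda>(x', y). x' = x \<longrightarrow> y \<in> W) V"
  shows "\<exists>G. openin (uniform_topology S V) G \<and> x \<in> G \<and> G \<subseteq> W"
proof -
  define G where "G = {z \<in> S. eventually (\<lambda>(x', y). x' = z \<longrightarrow> y \<in> W) V}"
  have "z \<in> W" if "z \<in> G" for z
    using that assms(1) unfolding G_def uniform_structure_on_def by fastforce
  moreover have "openin (uniform_topology S V) G"
    unfolding openin_uniform_topology
  proof (intro conjI ballI)
    fix z assume "z \<in> G"
    then have z: "z \<in> S" "eventually (\<lambda>(x', y). x' = z \<longrightarrow> y \<in> W) V"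
      by (auto simp: G_def)
    obtain D where D: "eventually D V"
      and DD: "\<And>u v w. u \<in> S \<Longrightarrow> v \<in> S \<Longrightarrow> w \<in> S \<Longrightarrow> D (u, v) \<Longrightarrow> D (v, w) \<Longrightarrow> u = z \<longrightarrow> w \<in> W"
      using uniform_structure_onD(4)[OF assms(1) z(2)] by (auto simp only: case_prod_conv)
    have S: "eventually (\<lambda>p. p \<in> S \<times> S) V"
      using assms(1) by (simp add: uniform_structure_on_def le_principal)
    \<comment> \<open>A \<open>D\<close>-step from \<open>z\<close> to \<open>y\<close> followed by
      a \<open>D\<close>-step from \<open>y\<close> ends in \<open>W\<close>, so within
      \<open>S\<close> the slice of \<open>D\<close> at \<open>y\<close> lies in
      \<open>W\<close>.\<close>
    have "y \<in> G" if "D (z, y)" "y \<in> S" for y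
    proof -
      from D S have "eventually (\<lambda>(x', w). x' = y \<longrightarrow> w \<in> W) V"
      proof eventually_elim
        case (elim p)
        then show ?case using DD[OF z(1) that(2) _ that(1)] by auto
      qed
      then show ?thesis using that(2) by (simp add: G_def)
    qed
    with D S show "eventually (\<lambda>(x', y). x' = z \<longrightarrow> y \<in> G) V"
      by (auto elim: eventually_elim2)
  qed (auto simp: G_def)
  ultimately show ?thesis
    using assms(2) ev by (auto simp: G_def)
qed

text \<open>Turns the equality of two topologies into a pointwise test: entourage slices and
  topological neighbourhoods refine each other. \<open>compatible_uniformityI\<close> is the
  converse passage.\<close>

lemma compatible_uniformityD:
  assumes "compatible_uniformity T V"
  shows "uniform_structure_on (topspace T) V"
    and "openin T W \<Longrightarrow> x \<in> W \<Longrightarrow> eventually (\<lambda>(x', y). x' = x \<longrightarrow> y \<in> W) V"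
    and "x \<in> topspace T \<Longrightarrow> eventually (\<lambda>(x', y). x' = x \<longrightarrow> y \<in> W) V \<Longrightarrow>
           \<exists>G. openin T G \<and> x \<in> G \<and> G \<subseteq> W"
proof -
  have V: "uniform_structure_on (topspace T) V" "uniform_topology (topspace T) V = T"
    using assms by (auto simp: compatible_uniformity_def)
  then show "uniform_structure_on (topspace T) V" by simp
  show "eventually (\<lambda>(x', y). x' = x \<longrightarrow> y \<in> W) V" if "openin T W" "x \<in> W"
    using that openin_uniform_topology[of "topspace T" V W] V(2) by auto
  show "\<exists>G. openin T G \<and> x \<in> G \<and> G \<subseteq> W"
    if "x \<in> topspace T" "eventually (\<lambda>(x', y). x' = x \<longrightarrow> y \<in> W) V"
    using uniform_topology_neighbourhood[OF V(1) that] V(2) by simp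
qed

lemma compatible_uniformityI:
  assumes "uniform_structure_on (topspace T) V"
    and "\<And>W x. openin T W \<Longrightarrow> x \<in> W \<Longrightarrow> eventually (\<lambda>(x', y). x' = x \<longrightarrow> y \<in> W) V"
    and "\<And>W x. x \<in> topspace T \<Longrightarrow> eventually (\<lambda>(x', y). x' = x \<longrightarrow> y \<in> W) V \<Longrightarrow>
           \<exists>G. openin T G \<and> x \<in> G \<and> G \<subseteq> W"
  shows "compatible_uniformity T V"
  unfolding compatible_uniformity_def topology_eq
proof (intro conjI allI iffI)
  fix W assume "openin T W"
  then show "openin (uniform_topology (topspace T) V) W"
    unfolding openin_uniform_topology using assms(2) openin_subset by blast
next
  fix W assume "openin (uniform_topology (topspace T) V) W"
  then show "openin T W"
    unfolding openin_uniform_topology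
    by (subst openin_subopen) (blast intro: assms(3))
qed (fact assms(1))

lemma uniform_structure_on_inf:
  assumes "uniform_structure_on S U" "uniform_structure_on S V"
  shows "uniform_structure_on S (inf U V)"
  unfolding uniform_structure_on_def
proof (intro conjI allI impI ballI)
  show "inf U V \<le> principal (S \<times> S)"
    using uniform_structure_onD(1)[OF assms(1)] by (rule inf.coboundedI1)
next
  fix E x assume "eventually E (inf U V)" "x \<in> S"
  then show "E (x, x)"
    using uniform_structure_onD(2)[OF assms(1)] uniform_structure_onD(2)[OF assms(2)]
    unfolding eventually_inf by blast
next
  fix E assume "eventually E (inf U V)"
  then obtain P Q where PQ: "eventually P U" "eventually Q V" "\<And>p. P p \<Longrightarrow> Q p \<Longrightarrow> E p"
    unfolding eventually_inf by blast
  then have "eventually (\<lambda>(x, y). P (y, x)) U" "eventually (\<lambda>(x, y). Q (y, x)) V"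
    using uniform_structure_onD(3)[OF assms(1)] uniform_structure_onD(3)[OF assms(2)] by auto
  then show "eventually (\<lambda>(x, y). E (y, x)) (inf U V)"
    unfolding eventually_inf using PQ(3) by fastforce
next
  fix E assume "eventually E (inf U V)"
  then obtain P Q where PQ: "eventually P U" "eventually Q V" "\<And>p. P p \<Longrightarrow> Q p \<Longrightarrow> E p"
    unfolding eventually_inf by blast
  obtain P' where P': "eventually P' U"
    "\<And>x y z. x \<in> S \<Longrightarrow> y \<in> S \<Longrightarrow> z \<in> S \<Longrightarrow> P' (x, y) \<Longrightarrow> P' (y, z) \<Longrightarrow> P (x, z)"
    using uniform_structure_onD(4)[OF assms(1) PQ(1)] by blast
  obtain Q' where Q': "eventually Q' V"
    "\<And>x y z. x \<in> S \<Longrightarrow> y \<in> S \<Longrightarrow> z \<in> S \<Longrightarrow> Q' (x, y) \<Longrightarrow> Q' (y, z) \<Longrightarrow> Q (x, z)"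
    using uniform_structure_onD(4)[OF assms(2) PQ(2)] by blast
  have "eventually (\<lambda>p. P' p \<and> Q' p) (inf U V)"
    using P'(1) Q'(1) unfolding eventually_inf by blast
  moreover have "E (x, z)" if "x \<in> S" "y \<in> S" "z \<in> S" "P' (x, y) \<and> Q' (x, y)" "P' (y, z) \<and> Q' (y, z)" for x y z
    using that P'(2)[of x y z] Q'(2)[of x y z] by (intro PQ(3)) auto
  ultimately show "\<exists>D. eventually D (inf U V) \<and>
      (\<forall>x\<in>S. \<forall>y\<in>S. \<forall>z\<in>S. D (x, y) \<longrightarrow> D (y, z) \<longrightarrow> E (x, z))"
    by blast
qed

text \<open>An entourage of the meet contains an intersection of one from \<open>U\<close> and one
  from \<open>V\<close>. Its slice at \<open>x\<close> contains an intersection of two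
  neighbourhoods for the same topology, so the meet yields no new open sets.\<close>

lemma compatible_uniformity_inf:
  assumes "compatible_uniformity T U" "compatible_uniformity T V"
  shows "compatible_uniformity T (inf U V)"
proof (rule compatible_uniformityI)
  show "uniform_structure_on (topspace T) (inf U V)"
    using assms by (intro uniform_structure_on_inf compatible_uniformityD(1))
next
  fix W x assume "openin T W" "x \<in> W"
  then show "eventually (\<lambda>(x', y). x' = x \<longrightarrow> y \<in> W) (inf U V)"
    using compatible_uniformityD(2)[OF assms(1)] by (metis filter_leD inf_le1)
next
  fix W x assume x: "x \<in> topspace T" "eventually (\<lambda>(x', y). x' = x \<longrightarrow> y \<in> W) (inf U V)"
  then obtain P Q where PQ: "eventually P U" "eventually Q V"
    "\<And>p. P p \<Longrightarrow> Q p \<Longrightarrow> (\<lambda>(x', y). x' = x \<longrightarrow> y \<in> W) p"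
    unfolding eventually_inf by blast
  have "eventually (\<lambda>(x', y). x' = x \<longrightarrow> y \<in> {y. P (x, y)}) U"
    using PQ(1) by (auto elim: eventually_mono)
  from compatible_uniformityD(3)[OF assms(1) x(1) this]
  obtain G where G: "openin T G" "x \<in> G" "G \<subseteq> {y. P (x, y)}" by blast
  have "eventually (\<lambda>(x', y). x' = x \<longrightarrow> y \<in> {y. Q (x, y)}) V"
    using PQ(2) by (auto elim: eventually_mono)
  from compatible_uniformityD(3)[OF assms(2) x(1) this]
  obtain H where H: "openin T H" "x \<in> H" "H \<subseteq> {y. Q (x, y)}" by blast
  have "G \<inter> H \<subseteq> W" using G(3) H(3) PQ(3) by auto
  then show "\<exists>G. openin T G \<and> x \<in> G \<and> G \<subseteq> W"
    using G H by (metis Int_iff openin_Int)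
qed

text \<open>Compatible uniformities are directed downwards under \<open>inf\<close>, so every
  entourage of their infimum is already an entourage of a single one, from which the axioms and the
  neighbourhood test are inherited. The given \<open>V\<close> keeps the family nonempty.\<close>

lemma finest_uniformity_exists:
  assumes "compatible_uniformity T V"
  shows "\<exists>U. finest_uniformity T U"
proof -
  define \<V> where "\<V> = {V. compatible_uniformity T V}"
  have ev: "eventually E (Inf \<V>) \<longleftrightarrow> (\<exists>V\<in>\<V>. eventually E V)" for E
  proof (rule eventually_Inf_base)
    fix F G assume "F \<in> \<V>" "G \<in> \<V>"
    then show "\<exists>V\<in>\<V>. V \<le> inf F G"
      unfolding \<V>_def by (blast intro: compatible_uniformity_inf)
  qed (use assms in \<open>auto simp: \<V>_def\<close>)
  have "compatible_uniformity T (Inf \<V>)"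
  proof (rule compatible_uniformityI)
    have S: "uniform_structure_on (topspace T) V" if "V \<in> \<V>" for V
      using that compatible_uniformityD(1) by (auto simp: \<V>_def)
    have "Inf \<V> \<le> principal (topspace T \<times> topspace T)"
      using assms compatible_uniformityD(1)[OF assms]
      by (intro Inf_lower2[of V]) (auto simp: \<V>_def uniform_structure_on_def)
    then show "uniform_structure_on (topspace T) (Inf \<V>)"
      unfolding uniform_structure_on_def ev
    proof (intro conjI allI impI ballI; (elim bexE)?)
      fix E V x assume "V \<in> \<V>" "eventually E V" "x \<in> topspace T"
      then show "E (x, x)" using uniform_structure_onD(2)[OF S] by blast
    next
      fix E V assume "V \<in> \<V>" "eventually E V"
      then show "\<exists>V\<in>\<V>. eventually (\<lambda>(x, y). E (y, x)) V"
        using uniform_structure_onD(3)[OF S] by blast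
    next
      fix E V assume V: "V \<in> \<V>" "eventually E V"
      from uniform_structure_onD(4)[OF S[OF V(1)] V(2)] V(1)
      show "\<exists>D. (\<exists>V\<in>\<V>. eventually D V) \<and> (\<forall>x\<in>topspace T. \<forall>y\<in>topspace T. \<forall>z\<in>topspace T.
          D (x, y) \<longrightarrow> D (y, z) \<longrightarrow> E (x, z))"
        by blast
    qed
  next
    fix W x assume "openin T W" "x \<in> W"
    then show "eventually (\<lambda>(x', y). x' = x \<longrightarrow> y \<in> W) (Inf \<V>)"
      unfolding ev using compatible_uniformityD(2)[OF assms] assms by (auto simp: \<V>_def)
  next
    fix W x assume x: "x \<in> topspace T" "eventually (\<lambda>(x', y). x' = x \<longrightarrow> y \<in> W) (Inf \<V>)"
    then obtain V where "V \<in> \<V>" "eventually (\<lambda>(x', y). x' = x \<longrightarrow> y \<in> W) V"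
      unfolding ev by blast
    then show "\<exists>G. openin T G \<and> x \<in> G \<and> G \<subseteq> W"
      using compatible_uniformityD(3)[OF _ x(1)] by (simp add: \<V>_def)
  qed
  then show ?thesis
    unfolding finest_uniformity_def by (auto simp: \<V>_def intro: Inf_lower)
qed

section \<open>Continuous pseudometrics\<close>

text \<open>Continuity is required only at the diagonal; the triangle inequality spreads it to both
  variables. Nonnegativity on the space is likewise a consequence, from
  \<open>d x x \<le> d x y + d y x\<close>.\<close>

definition continuous_pseudometric :: "'a topology \<Rightarrow> ('a \<Rightarrow> 'a \<Rightarrow> real) \<Rightarrow> bool" where
  "continuous_pseudometric T d \<longleftrightarrow>
     (\<forall>x\<in>topspace T. d x x = 0) \<and>
     (\<forall>x\<in>topspace T. \<forall>y\<in>topspace T. d x y = d y x) \<and>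
     (\<forall>x\<in>topspace T. \<forall>y\<in>topspace T. \<forall>z\<in>topspace T. d x z \<le> d x y + d y z) \<and>
     (\<forall>x\<in>topspace T. \<forall>\<epsilon>>0. \<exists>G. openin T G \<and> x \<in> G \<and> (\<forall>y\<in>G. d x y < \<epsilon>))"

lemma continuous_pseudometricD:
  assumes "continuous_pseudometric T d"
  shows "x \<in> topspace T \<Longrightarrow> d x x = 0"
    and "x \<in> topspace T \<Longrightarrow> y \<in> topspace T \<Longrightarrow> d x y = d y x"
    and "x \<in> topspace T \<Longrightarrow> y \<in> topspace T \<Longrightarrow> z \<in> topspace T \<Longrightarrow> d x z \<le> d x y + d y z"
    and "x \<in> topspace T \<Longrightarrow> \<epsilon> > 0 \<Longrightarrow> \<exists>G. openin T G \<and> x \<in> G \<and> (\<forall>y\<in>G. d x y < \<epsilon>)"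
  using assms unfolding continuous_pseudometric_def by blast+

lemma continuous_pseudometric_nonneg:
  assumes d: "continuous_pseudometric T d" and "x \<in> topspace T" "y \<in> topspace T"
  shows "0 \<le> d x y"
  using continuous_pseudometricD(1)[OF d, of x] continuous_pseudometricD(2)[OF d, of x y]
    continuous_pseudometricD(3)[OF d, of x y x] assms(2,3) by linarith

text \<open>The balls of \<open>d\<close> are neighbourhoods in \<open>T\<close>, so meeting
  \<open>U\<close> with the uniformity of \<open>d\<close> leaves the topology unchanged. The meet
  is then compatible, and since \<open>U\<close> is the finest it lies below the meet.\<close>

lemma finest_uniformity_pseudometric:
  assumes "finest_uniformity T U" and d: "continuous_pseudometric T d" and "\<epsilon> > 0"
  shows "eventually (\<lambda>(x, y). d x y < \<epsilon>) U"
proof -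
  let ?S = "topspace T"
  let ?N = "\<lambda>\<epsilon>. principal {(x, y) \<in> ?S \<times> ?S. d x y < \<epsilon>}"
  \<comment> \<open>\<open>D\<close> is the uniformity generated by \<open>d\<close>. Its own
    topology may be strictly coarser than \<open>T\<close>, hence the detour through
    \<open>inf U D\<close>.\<close>
  define D where "D = (INF \<epsilon>\<in>{0::real<..}. ?N \<epsilon>)"
  have ev: "eventually E D \<longleftrightarrow> (\<exists>\<epsilon>>0. \<forall>x\<in>?S. \<forall>y\<in>?S. d x y < \<epsilon> \<longrightarrow> E (x, y))" for E
  proof -
    have "eventually E D \<longleftrightarrow> (\<exists>\<epsilon>\<in>{0<..}. eventually E (?N \<epsilon>))"
      unfolding D_def
    proof (rule eventually_INF_base)
      fix a b :: real assume "a \<in> {0<..}" "b \<in> {0<..}"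
      then show "\<exists>c\<in>{0<..}. ?N c \<le> inf (?N a) (?N b)"
        by (intro bexI[of _ "min a b"]) auto
    qed (use greaterThan_non_empty in blast)
    then show ?thesis by (auto simp: eventually_principal Bex_def)
  qed
  have D: "uniform_structure_on ?S D"
    unfolding uniform_structure_on_def
  proof (intro conjI allI impI ballI)
    show "D \<le> principal (?S \<times> ?S)"
      unfolding le_principal ev by (auto intro: exI[of _ 1])
  next
    fix E x assume "eventually E D" "x \<in> ?S"
    then show "E (x, x)"
      using continuous_pseudometricD(1)[OF d] unfolding ev by metis
  next
    fix E assume "eventually E D"
    then show "eventually (\<lambda>(x, y). E (y, x)) D"
      using continuous_pseudometricD(2)[OF d] unfolding ev by (metis case_prod_conv)
  next
    fix E assume "eventually E D"
    then obtain \<delta> where \<delta>: "\<delta> > 0" "\<And>x y. x \<in> ?S \<Longrightarrow> y \<in> ?S \<Longrightarrow> d x y < \<delta> \<Longrightarrow> E (x, y)"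
      unfolding ev by blast
    have "eventually (\<lambda>(x, y). d x y < \<delta> / 2) D"
      unfolding ev using \<delta>(1) by (intro exI[of _ "\<delta> / 2"]) auto
    moreover have "E (x, z)"
      if "x \<in> ?S" "y \<in> ?S" "z \<in> ?S" "d x y < \<delta> / 2" "d y z < \<delta> / 2" for x y z
      using \<delta>(2)[of x z] continuous_pseudometricD(3)[OF d, of x y z] that by linarith
    ultimately show "\<exists>P. eventually P D \<and>
        (\<forall>x\<in>?S. \<forall>y\<in>?S. \<forall>z\<in>?S. P (x, y) \<longrightarrow> P (y, z) \<longrightarrow> E (x, z))"
      by (intro exI[of _ "\<lambda>(x, y). d x y < \<delta> / 2"]) auto
  qed
  have U: "compatible_uniformity T U"
    using assms(1) by (simp add: finest_uniformity_def)
  have "compatible_uniformity T (inf U D)"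
  proof (rule compatible_uniformityI)
    show "uniform_structure_on ?S (inf U D)"
      by (intro uniform_structure_on_inf D compatible_uniformityD(1) U)
  next
    fix W x assume "openin T W" "x \<in> W"
    then show "eventually (\<lambda>(x', y). x' = x \<longrightarrow> y \<in> W) (inf U D)"
      using compatible_uniformityD(2)[OF U] by (metis filter_leD inf_le1)
  next
    fix W x assume x: "x \<in> ?S" "eventually (\<lambda>(x', y). x' = x \<longrightarrow> y \<in> W) (inf U D)"
    then obtain P Q where PQ: "eventually P U" "eventually Q D"
      "\<And>p. P p \<Longrightarrow> Q p \<Longrightarrow> (\<lambda>(x', y). x' = x \<longrightarrow> y \<in> W) p"
      unfolding eventually_inf by blast
    have "eventually (\<lambda>(x', y). x' = x \<longrightarrow> y \<in> {y. P (x, y)}) U"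
      using PQ(1) by (auto elim: eventually_mono)
    from compatible_uniformityD(3)[OF U x(1) this]
    obtain G where G: "openin T G" "x \<in> G" "G \<subseteq> {y. P (x, y)}" by blast
    obtain \<delta> where \<delta>: "\<delta> > 0" "\<And>x y. x \<in> ?S \<Longrightarrow> y \<in> ?S \<Longrightarrow> d x y < \<delta> \<Longrightarrow> Q (x, y)"
      using PQ(2) unfolding ev by blast
    obtain H where H: "openin T H" "x \<in> H" "\<forall>y\<in>H. d x y < \<delta>"
      using continuous_pseudometricD(4)[OF d x(1) \<delta>(1)] by blast
    have "G \<inter> H \<subseteq> W"
      using G(3) H(3) PQ(3) \<delta>(2)[OF x(1)] openin_subset[OF H(1)] by fastforce
    then show "\<exists>G. openin T G \<and> x \<in> G \<and> G \<subseteq> W"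
      using G H by (metis Int_iff openin_Int)
  qed
  then have "U \<le> inf U D"
    using assms(1) unfolding finest_uniformity_def by blast
  then have "U \<le> D" by simp
  moreover have "eventually (\<lambda>(x, y). d x y < \<epsilon>) D"
    unfolding ev using assms(3) by auto
  ultimately show ?thesis by (rule filter_leD)
qed

text \<open>
  This is why a metrisable space, complete or not, is Dieudonne complete: the distance
  \<open>\<phi>\<close> to the limit of \<open>F\<close> in the completion must vanish somewhere, since otherwise
  \<open>1 / \<phi>\<close> would be a continuous function unbounded along \<open>F\<close>.
\<close>

lemma Cauchy_filter_pseudometric_limit:
  assumes U: "finest_uniformity T U" and d: "continuous_pseudometric T d"
    and F: "F \<noteq> bot" "F \<le> principal (topspace T)" "F \<times>\<^sub>F F \<le> U"
  shows "\<exists>g\<in>topspace T. ((\<lambda>h. d g h) \<longlongrightarrow> 0) F"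
proof (rule ccontr)
  assume contra: "\<not> ?thesis"
  let ?S = "topspace T"
  have FS: "eventually (\<lambda>h. h \<in> ?S) F"
    using F(2) by (simp add: le_principal)
  \<comment> \<open>The estimate is for an arbitrary continuous pseudometric because it serves
    twice: for \<open>d\<close> and for the \<open>e\<close> built below from the reciprocal of
    \<open>\<phi>\<close>.\<close>
  have Cauchy: "\<exists>P. eventually P F \<and> (\<forall>g h. P g \<longrightarrow> P h \<longrightarrow> g \<in> ?S \<and> e g h < \<epsilon>)"
    if "continuous_pseudometric T e" "\<epsilon> > 0" for e \<epsilon>
  proof -
    have "eventually (\<lambda>(g, h). e g h < \<epsilon>) (F \<times>\<^sub>F F)"
      using finest_uniformity_pseudometric[OF U that] F(3) by (rule filter_leD[rotated])
    then obtain P where "eventually P F" "\<forall>g h. P g \<longrightarrow> P h \<longrightarrow> e g h < \<epsilon>"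
      unfolding eventually_prod_same by auto
    then show ?thesis
      using FS by (intro exI[of _ "\<lambda>g. P g \<and> g \<in> ?S"]) (auto elim: eventually_elim2)
  qed
  have rev: "\<bar>d g h - d g k\<bar> \<le> d h k" if "g \<in> ?S" "h \<in> ?S" "k \<in> ?S" for g h k
    using continuous_pseudometricD(2)[OF d, of h k] continuous_pseudometricD(3)[OF d, of g h k]
      continuous_pseudometricD(3)[OF d, of g k h] that by linarith
  have lim: "\<exists>l. ((\<lambda>h. d g h) \<longlongrightarrow> l) F" if g: "g \<in> ?S" for g
  proof -
    \<comment> \<open>By the reverse triangle inequality \<open>d g\<close> maps \<open>F\<close> to
      a Cauchy filter of reals, which converges.\<close>
    have "cauchy_filter (filtermap (d g) F)"
      unfolding cauchy_filter_metric_filtermap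
    proof (intro allI impI)
      fix \<epsilon> :: real assume "\<epsilon> > 0"
      then obtain P where P: "eventually P F" "\<And>h k. P h \<Longrightarrow> P k \<Longrightarrow> h \<in> ?S \<and> d h k < \<epsilon>"
        using Cauchy[OF d] by blast
      have "dist (d g h) (d g k) < \<epsilon>" if "P h" "P k" for h k
        using rev[OF g, of h k] P(2)[of h k] P(2)[of k h] that by (auto simp: dist_real_def)
      then show "\<exists>P. eventually P F \<and> (\<forall>x y. P x \<and> P y \<longrightarrow> dist (d g x) (d g y) < \<epsilon>)"
        using P(1) by blast
    qed
    then show ?thesis
      using complete_UNIV[where 'a = real] F(1)
      unfolding complete_uniform filterlim_def by (auto simp: filtermap_bot_iff)
  qed
  define \<phi> where "\<phi> g = (SOME l. ((\<lambda>h. d g h) \<longlongrightarrow> l) F)" for g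
  have \<phi>: "((\<lambda>h. d g h) \<longlongrightarrow> \<phi> g) F" if "g \<in> ?S" for g
    unfolding \<phi>_def using lim[OF that] by (rule someI_ex)
  \<comment> \<open>A zero of \<open>\<phi>\<close> would be a limit point of the kind that
    \<open>contra\<close> denies.\<close>
  have \<phi>_pos: "\<phi> g > 0" if "g \<in> ?S" for g
  proof -
    have "0 \<le> \<phi> g"
      using \<phi>[OF that] F(1) FS continuous_pseudometric_nonneg[OF d that]
      by (intro tendsto_lowerbound[where F = F and f = "d g"]) (auto elim: eventually_mono)
    moreover have "\<phi> g \<noteq> 0" using \<phi>[OF that] contra that by auto
    ultimately show ?thesis by simp
  qed
  have \<phi>_lip: "\<bar>\<phi> g - \<phi> h\<bar> \<le> d g h" if "g \<in> ?S" "h \<in> ?S" for g h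
  proof (rule tendsto_upperbound)
    show "((\<lambda>k. \<bar>d g k - d h k\<bar>) \<longlongrightarrow> \<bar>\<phi> g - \<phi> h\<bar>) F"
      by (intro tendsto_intros \<phi> that)
    show "eventually (\<lambda>k. \<bar>d g k - d h k\<bar> \<le> d g h) F"
      using FS
    proof eventually_elim
      case (elim k)
      then show ?case
        using rev[of k g h] continuous_pseudometricD(2)[OF d, of k g]
          continuous_pseudometricD(2)[OF d, of k h] that by simp
    qed
  qed (fact F(1))
  \<comment> \<open>The pullback of the usual distance along \<open>1 / \<phi>\<close>; it is
    continuous because \<open>\<phi>\<close> is positive and 1-Lipschitz for
    \<open>d\<close>.\<close>
  define e where "e g h = \<bar>1 / \<phi> g - 1 / \<phi> h\<bar>" for g h
  have e: "continuous_pseudometric T e"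
    unfolding continuous_pseudometric_def
  proof (intro conjI ballI allI impI)
    fix g and \<epsilon> :: real assume g: "g \<in> ?S" and "\<epsilon> > 0"
    have "isCont (\<lambda>t. 1 / t) (\<phi> g)"
      using \<phi>_pos[OF g] by (intro continuous_intros) auto
    then obtain \<delta> where \<delta>: "\<delta> > 0" "\<And>t. dist t (\<phi> g) < \<delta> \<Longrightarrow> dist (1 / t) (1 / \<phi> g) < \<epsilon>"
      using \<open>\<epsilon> > 0\<close> unfolding continuous_at_eps_delta by metis
    obtain G where G: "openin T G" "g \<in> G" "\<forall>h\<in>G. d g h < \<delta>"
      using continuous_pseudometricD(4)[OF d g \<delta>(1)] by blast
    have "e g h < \<epsilon>" if "h \<in> G" for h
    proof -
      have "h \<in> ?S" using openin_subset[OF G(1)] that by blast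
      from \<phi>_lip[OF g this] \<delta>(2)[of "\<phi> h"] G(3) that show ?thesis
        unfolding e_def dist_real_def by (simp add: abs_minus_commute) fastforce
    qed
    then show "\<exists>G. openin T G \<and> g \<in> G \<and> (\<forall>h\<in>G. e g h < \<epsilon>)"
      using G by blast
  qed (auto simp: e_def)
  obtain P where P: "eventually P F" "\<And>g h. P g \<Longrightarrow> P h \<Longrightarrow> g \<in> ?S \<and> e g h < 1"
    using Cauchy[OF e zero_less_one] by blast
  obtain g where "P g"
    using P(1) F(1) eventually_happens' by blast
  then have g: "g \<in> ?S" using P(2) by blast
  \<comment> \<open>On \<open>P\<close> the value of \<open>1 / \<phi>\<close> is below
    \<open>1 + 1 / \<phi> g\<close>, so \<open>\<phi>\<close> exceeds this
    \<open>\<epsilon>\<close>. A common member \<open>h\<close> of \<open>P\<close> and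
    \<open>Q\<close> will violate that.\<close>
  define \<epsilon> where "\<epsilon> = 1 / (1 + 1 / \<phi> g)"
  have \<epsilon>: "\<epsilon> > 0" using \<phi>_pos[OF g] by (simp add: \<epsilon>_def add_pos_pos)
  obtain Q where Q: "eventually Q F" "\<And>h k. Q h \<Longrightarrow> Q k \<Longrightarrow> h \<in> ?S \<and> d h k < \<epsilon> / 2"
    using Cauchy[OF d, of "\<epsilon> / 2"] \<epsilon> by (meson half_gt_zero)
  obtain h where h: "P h" "Q h"
    using P(1) Q(1) F(1) eventually_happens'[of F "\<lambda>h. P h \<and> Q h"] eventually_conj by blast
  have hS: "h \<in> ?S" using P(2) h by blast
  \<comment> \<open>All of \<open>Q\<close> lies within \<open>\<epsilon> / 2\<close> of
    \<open>h\<close>, and \<open>\<phi> h\<close> is the limit of these distances.\<close>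
  have "\<phi> h \<le> \<epsilon> / 2"
    using \<phi>[OF hS] F(1) Q h(2)
    by (intro tendsto_upperbound[where F = F and f = "d h"]) (auto elim!: eventually_mono intro: less_imp_le)
  then have "\<phi> h < \<epsilon>" using \<epsilon> by simp
  then have "1 / \<epsilon> < 1 / \<phi> h"
    using \<phi>_pos[OF hS] by (simp add: frac_less2)
  moreover have "1 / \<phi> h < 1 + 1 / \<phi> g"
    using P(2)[OF \<open>P g\<close> h(1)] unfolding e_def by linarith
  ultimately show False by (simp add: \<epsilon>_def)
qed

section \<open>Tychonoff spaces from continuous pseudometrics\<close>

lemma tychonoff_space_pseudometrics:
  assumes nbhd: "\<And>W x. openin T W \<Longrightarrow> x \<in> W \<Longrightarrow>
      \<exists>d \<epsilon>. continuous_pseudometric T d \<and> \<epsilon> > 0 \<and> (\<forall>y\<in>topspace T. d x y < \<epsilon> \<longrightarrow> y \<in> W)"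
    and sep: "\<And>x y. x \<in> topspace T \<Longrightarrow> y \<in> topspace T \<Longrightarrow> x \<noteq> y \<Longrightarrow>
      \<exists>d. continuous_pseudometric T d \<and> d x y > 0"
  shows "tychonoff_space T"
  unfolding tychonoff_space_def
proof
  show "completely_regular_space T"
    unfolding completely_regular_space_def
  proof (intro allI impI)
    fix K x assume Kx: "closedin T K \<and> x \<in> topspace T - K"
    then obtain d \<epsilon> where d: "continuous_pseudometric T d" and \<epsilon>: "\<epsilon> > 0"
      and dK: "\<And>y. y \<in> topspace T \<Longrightarrow> d x y < \<epsilon> \<Longrightarrow> y \<notin> K"
      using nbhd[of "topspace T - K" x] by (auto simp: openin_diff)
    have x: "x \<in> topspace T" using Kx by blast
    have "continuous_map T euclideanreal (d x)"
      unfolding continuous_map_def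
    proof (intro conjI allI impI)
      fix W :: "real set" assume "openin euclidean W"
      then have W: "open W" by simp
      show "openin T {y \<in> topspace T. d x y \<in> W}"
      proof (subst openin_subopen, intro ballI)
        fix y assume "y \<in> {y \<in> topspace T. d x y \<in> W}"
        then have y: "y \<in> topspace T" "d x y \<in> W" by auto
        obtain \<delta> where \<delta>: "\<delta> > 0" "ball (d x y) \<delta> \<subseteq> W"
          using W y(2) open_contains_ball by blast
        obtain G where G: "openin T G" "y \<in> G" "\<forall>z\<in>G. d y z < \<delta>"
          using continuous_pseudometricD(4)[OF d y(1) \<delta>(1)] by blast
        have "d x z \<in> W" if "z \<in> G" for z
        proof -
          have "z \<in> topspace T" using openin_subset[OF G(1)] that by blast
          then have "\<bar>d x y - d x z\<bar> < \<delta>"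
            using continuous_pseudometricD(2)[OF d, of y z]
              continuous_pseudometricD(3)[OF d, of x y z]
              continuous_pseudometricD(3)[OF d, of x z y] that G(3) x y by fastforce
          then show ?thesis using \<delta>(2) by (auto simp: dist_real_def)
        qed
        then show "\<exists>G. openin T G \<and> y \<in> G \<and> G \<subseteq> {y \<in> topspace T. d x y \<in> W}"
          using G openin_subset[OF G(1)] by blast
      qed
    qed simp
    \<comment> \<open>Rescaled and truncated, the distance from \<open>x\<close> vanishes at
      \<open>x\<close> and equals 1 on \<open>K\<close>, whose points are at distance at least
      \<open>\<epsilon>\<close>.\<close>
    then have "continuous_map T euclideanreal (\<lambda>y. min 1 (d x y / \<epsilon>))"
      using \<epsilon> by (intro continuous_intros) auto
    moreover have "0 \<le> d x y" if "y \<in> topspace T" for y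
      using continuous_pseudometric_nonneg[OF d x that] .
    ultimately have "continuous_map T (top_of_set {0..1}) (\<lambda>y. min 1 (d x y / \<epsilon>))"
      using \<epsilon> by (auto simp: continuous_map_in_subtopology)
    moreover have "min 1 (d x y / \<epsilon>) = 1" if "y \<in> K" for y
    proof -
      have "\<epsilon> \<le> d x y"
        using dK[of y] closedin_subset[of T K] Kx that by fastforce
      then show ?thesis using \<epsilon> by simp
    qed
    ultimately show "\<exists>f. continuous_map T (top_of_set {0..1::real}) f \<and> f x = 0 \<and> f ` K \<subseteq> {1}"
      using continuous_pseudometricD(1)[OF d x]
      by (intro exI[of _ "\<lambda>y. min 1 (d x y / \<epsilon>)"]) auto
  qed
next
  show "Hausdorff_space T"
    unfolding Hausdorff_space_def
  proof (intro allI impI)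
    fix x y assume xy: "x \<in> topspace T \<and> y \<in> topspace T \<and> x \<noteq> y"
    then obtain d where d: "continuous_pseudometric T d" and r: "d x y > 0"
      using sep by blast
    obtain G where G: "openin T G" "x \<in> G" "\<forall>z\<in>G. d x z < d x y / 2"
      using continuous_pseudometricD(4)[OF d, of x "d x y / 2"] xy r by auto
    obtain H where H: "openin T H" "y \<in> H" "\<forall>z\<in>H. d y z < d x y / 2"
      using continuous_pseudometricD(4)[OF d, of y "d x y / 2"] xy r by auto
    have False if "z \<in> G" "z \<in> H" for z
    proof -
      have "z \<in> topspace T" using openin_subset[OF G(1)] that by blast
      then show False
        using continuous_pseudometricD(2)[OF d, of y z] continuous_pseudometricD(3)[OF d, of x z y]
          xy G(3) H(3) that by fastforce
    qed
    then show "\<exists>U V. openin T U \<and> openin T V \<and> x \<in> U \<and> y \<in> V \<and> disjnt U V"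
      using G H unfolding disjnt_iff by blast
  qed
qed

section \<open>Weighted pseudometrics on the function space\<close>

text \<open>
  The empty set is added to \<open>\<L>\<close> so that the case of an empty space needs no separate treatment.
\<close>

lemma eventually_cfun_uniformity':
  fixes m :: "'b metric"
  assumes "bornology (topspace X) \<L>"
  defines "C \<equiv> cfuns X (mtopology_of m)"
  shows "eventually E (cfun_uniformity X \<L> m) \<longleftrightarrow>
     (\<exists>A\<in>insert {} \<L>. \<exists>\<epsilon>>0. \<forall>f\<in>C. \<forall>g\<in>C. (\<forall>x\<in>A. mdist m (f x) (g x) < \<epsilon>) \<longrightarrow> E (f, g))"
proof (cases "\<L> = {}")
  case True
  then show ?thesis
    unfolding cfun_uniformity_def Let_def C_def
    by (auto simp: eventually_principal intro: exI[of _ 1])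
next
  case False
  show ?thesis
    unfolding eventually_cfun_uniformity[OF assms(1) False] C_def
    using False by (metis ex_in_conv insertCI insertE)
qed

lemma compatible_cfun_uniformity:
  assumes "bornology (topspace X) \<L>"
  shows "topspace (cfun_topology X \<L> m) = cfuns X (mtopology_of m)"
    and "compatible_uniformity (cfun_topology X \<L> m) (cfun_uniformity X \<L> m)"
  using topspace_uniform_topology[OF uniform_structure_on_cfun_uniformity[OF assms, of m]]
    uniform_structure_on_cfun_uniformity[OF assms, of m]
  by (auto simp: compatible_uniformity_def cfun_topology_def)

lemma cfun_topology_neighbourhood:
  assumes \<L>: "bornology (topspace X) \<L>"
    and W: "openin (cfun_topology X \<L> m) W" "f \<in> W"
  shows "\<exists>A\<in>insert {} \<L>. \<exists>\<epsilon>>0. \<forall>g\<in>cfuns X (mtopology_of m).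
           (\<forall>x\<in>A. mdist m (f x) (g x) < \<epsilon>) \<longrightarrow> g \<in> W"
proof -
  have "f \<in> cfuns X (mtopology_of m)"
    using openin_subset[OF W(1)] W(2) compatible_cfun_uniformity(1)[OF \<L>, of m] by blast
  then show ?thesis
    using compatible_uniformityD(2)[OF compatible_cfun_uniformity(2)[OF \<L>] W]
    unfolding eventually_cfun_uniformity'[OF \<L>] by (simp add: Bex_def) blast
qed

text \<open>
  For \<open>A = \<Union>n. A n\<close> in \<open>countable_unions \<L>\<close>, a vanishing weight equal to \<open>(1 / 2) ^ n\<close> on the
  points first covered by \<open>A n\<close> makes a single continuous pseudometric control all of \<open>A\<close>.
\<close>

definition vanishing_weight :: "'a set set \<Rightarrow> ('a \<Rightarrow> real) \<Rightarrow> bool" where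
  "vanishing_weight \<L> w \<longleftrightarrow>
     (\<forall>x. 0 \<le> w x \<and> w x \<le> 1) \<and> (\<forall>\<epsilon>>0. \<exists>A\<in>insert {} \<L>. \<forall>x. \<epsilon> \<le> w x \<longrightarrow> x \<in> A)"

text \<open>A vanishing weight truncates the distance, which keeps the supremum finite for unbounded
  functions. For a bornology it is zero off the space, so the supremum can run over the whole
  type.\<close>

definition weighted_dist :: "'b metric \<Rightarrow> ('a \<Rightarrow> real) \<Rightarrow> ('a \<Rightarrow> 'b) \<Rightarrow> ('a \<Rightarrow> 'b) \<Rightarrow> real" where
  "weighted_dist m w f g = (SUP x. min (w x) (mdist m (f x) (g x)))"

lemma weighted_dist_upper:
  assumes "vanishing_weight \<L> w"
  shows "min (w x) (mdist m (f x) (g x)) \<le> weighted_dist m w f g"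
  unfolding weighted_dist_def
proof (rule cSUP_upper)
  show "bdd_above (range (\<lambda>x. min (w x) (mdist m (f x) (g x))))"
    using assms unfolding vanishing_weight_def by (intro bdd_aboveI[of _ 1]) (auto intro: min.coboundedI1)
qed simp

lemma weighted_dist_least:
  assumes "\<And>x. min (w x) (mdist m (f x) (g x)) \<le> c"
  shows "weighted_dist m w f g \<le> c"
  unfolding weighted_dist_def using assms by (intro cSUP_least) auto

lemma vanishing_weight_support:
  assumes "bornology X \<L>" "vanishing_weight \<L> w" "w x > 0"
  shows "x \<in> X"
proof -
  obtain A where "A \<in> insert {} \<L>" "x \<in> A"
    using assms(2,3) unfolding vanishing_weight_def by (meson order_refl)
  then show ?thesis using assms(1) unfolding bornology_def by blast
qed

lemma cfuns_mspace:
  "f \<in> cfuns X (mtopology_of m) \<Longrightarrow> x \<in> topspace X \<Longrightarrow> f x \<in> mspace m"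
  by (auto simp: cfuns_def continuous_map_def)

text \<open>Truncation at a fixed height preserves the triangle inequality. For continuity, the
  weight is below \<open>\<epsilon> / 2\<close> outside one member of \<open>insert {} \<L>\<close>,
  so uniform closeness on that member controls the whole supremum.\<close>

lemma continuous_pseudometric_weighted_dist:
  assumes \<L>: "bornology (topspace X) \<L>" and w: "vanishing_weight \<L> w"
  shows "continuous_pseudometric (cfun_topology X \<L> m) (weighted_dist m w)"
proof -
  let ?T = "cfun_topology X \<L> m" and ?C = "cfuns X (mtopology_of m)"
  note top = compatible_cfun_uniformity(1)[OF \<L>, of m]
  have w0: "0 \<le> w x" for x using w by (simp add: vanishing_weight_def)
  have min_triangle: "min c t \<le> min c u + min c v" if "0 \<le> c" "0 \<le> u" "0 \<le> v" "t \<le> u + v"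
    for c t u v :: real
    using that by linarith
  have supp: "x \<in> topspace X \<or> w x = 0" for x
    using vanishing_weight_support[OF \<L> w, of x] w0[of x] by fastforce
  show ?thesis
    unfolding continuous_pseudometric_def top
  proof (intro conjI ballI allI impI)
    fix f assume f: "f \<in> ?C"
    have "min (w x) (mdist m (f x) (f x)) = 0" for x
    proof (cases "x \<in> topspace X")
      case True
      then have "mdist m (f x) (f x) = 0" using cfuns_mspace[OF f] by simp
      then show ?thesis using w0[of x] by simp
    qed (use supp[of x] in simp)
    then show "weighted_dist m w f f = 0" by (simp add: weighted_dist_def)
  next
    fix f g show "weighted_dist m w f g = weighted_dist m w g f"
      by (simp add: weighted_dist_def mdist_commute)
  next
    fix f g h assume C: "f \<in> ?C" "g \<in> ?C" "h \<in> ?C"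
    show "weighted_dist m w f h \<le> weighted_dist m w f g + weighted_dist m w g h"
    proof (rule weighted_dist_least)
      fix x
      have "min (w x) (mdist m (f x) (h x))
          \<le> min (w x) (mdist m (f x) (g x)) + min (w x) (mdist m (g x) (h x))"
      proof (cases "x \<in> topspace X")
        case True
        then have "mdist m (f x) (h x) \<le> mdist m (f x) (g x) + mdist m (g x) (h x)"
          by (intro mdist_triangle cfuns_mspace[OF _ True] C)
        then show ?thesis
          using min_triangle[OF w0] by simp
      next
        case False
        then show ?thesis using supp[of x] by auto
      qed
      also have "\<dots> \<le> weighted_dist m w f g + weighted_dist m w g h"
        by (intro add_mono weighted_dist_upper[OF w])
      finally show "min (w x) (mdist m (f x) (h x)) \<le> \<dots>" .
    qed
  next
    fix f and \<epsilon> :: real assume f: "f \<in> ?C" and \<epsilon>: "\<epsilon> > 0"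
    then obtain A where A: "A \<in> insert {} \<L>" "\<And>x. \<epsilon> / 2 \<le> w x \<Longrightarrow> x \<in> A"
      using w unfolding vanishing_weight_def by (meson half_gt_zero)
    have close: "weighted_dist m w f g < \<epsilon>" if "\<forall>x\<in>A. mdist m (f x) (g x) < \<epsilon> / 2" for g
    proof -
      \<comment> \<open>Strict pointwise bounds give only a weak bound for the supremum; halving
        \<open>\<epsilon>\<close> restores strictness.\<close>
      have "weighted_dist m w f g \<le> \<epsilon> / 2"
      proof (rule weighted_dist_least)
        fix x show "min (w x) (mdist m (f x) (g x)) \<le> \<epsilon> / 2"
          using A(2)[of x] that by (cases "\<epsilon> / 2 \<le> w x") (auto intro: min.coboundedI2 less_imp_le)
      qed
      then show ?thesis using \<epsilon> by simp
    qed
    have "eventually (\<lambda>(f', g). f' = f \<longrightarrow> g \<in> {g. weighted_dist m w f g < \<epsilon>}) (cfun_uniformity X \<L> m)"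
      unfolding eventually_cfun_uniformity'[OF \<L>]
      using A(1) \<epsilon> close by (intro bexI[of _ A] exI[of _ "\<epsilon> / 2"]) auto
    from compatible_uniformityD(3)[OF compatible_cfun_uniformity(2)[OF \<L>] _ this] f
    show "\<exists>G. openin ?T G \<and> f \<in> G \<and> (\<forall>g\<in>G. weighted_dist m w f g < \<epsilon>)"
      by (auto simp: top)
  qed
qed

text \<open>With this weight \<open>weighted_dist\<close> is the uniform distance on
  \<open>A\<close> truncated at 1, so single members of \<open>\<L>\<close> fall under the same
  construction as countable unions.\<close>

lemma vanishing_weight_indicator:
  assumes "A \<in> insert {} \<L>"
  shows "vanishing_weight \<L> (indicator A)"
proof -
  have "\<forall>x. \<epsilon> \<le> (indicator A x :: real) \<longrightarrow> x \<in> A" if "\<epsilon> > 0" for \<epsilon>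
    using that by (simp add: indicator_def)
  then show ?thesis
    unfolding vanishing_weight_def using assms by blast
qed

lemma vanishing_weight_countable_union:
  assumes \<L>: "bornology X \<L>" and A: "A \<in> countable_unions \<L>"
  shows "\<exists>w. vanishing_weight \<L> w \<and> (\<forall>x\<in>A. w x > 0)"
proof -
  obtain \<A> where \<A>: "A = \<Union>\<A>" "\<A> \<subseteq> \<L>" "\<A> \<noteq> {}" "countable \<A>"
    using A unfolding countable_unions_def by blast
  define B where "B = from_nat_into \<A>"
  have B: "range B = \<A>" unfolding B_def using \<A>(3,4) by (rule range_from_nat_into)
  \<comment> \<open>\<open>N = 0\<close> gives the empty union, which is not a member of the
    bornology; hence \<open>insert {}\<close>.\<close>
  have Un: "(\<Union>n<N. B n) \<in> insert {} \<L>" for N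
  proof (induction N)
    case (Suc N)
    have "B N \<in> \<L>" using B \<A>(2) by auto
    moreover have "\<forall>A\<in>\<L>. \<forall>B\<in>\<L>. A \<union> B \<in> \<L>"
      using \<L> unfolding bornology_def by blast
    ultimately have "B N \<union> (\<Union>n<N. B n) \<in> \<L>"
      using Suc by (metis Un_empty_right insertE)
    then show ?case by (simp add: lessThan_Suc)
  qed simp
  define w where "w x = (if x \<in> A then (1 / 2 :: real) ^ (LEAST n. x \<in> B n) else 0)" for x
  have "vanishing_weight \<L> w"
    unfolding vanishing_weight_def
  proof (intro conjI allI impI)
    fix x show "0 \<le> w x" "w x \<le> 1" by (auto simp: w_def power_le_one)
  next
    fix \<epsilon> :: real assume "\<epsilon> > 0"
    \<comment> \<open>Points first covered at index \<open>N\<close> or later have weight below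
      \<open>\<epsilon>\<close>, so the remaining ones lie in the finitely many \<open>B n\<close>
      with \<open>n < N\<close>.\<close>
    then obtain N where N: "(1 / 2 :: real) ^ N < \<epsilon>"
      using real_arch_pow_inv[of \<epsilon> "1 / 2"] by auto
    have "x \<in> (\<Union>n<N. B n)" if x: "\<epsilon> \<le> w x" for x
    proof -
      have xA: "x \<in> A" using x \<open>\<epsilon> > 0\<close> by (auto simp: w_def split: if_splits)
      then obtain n where "x \<in> B n" using \<A>(1) B by auto
      then have "x \<in> B (LEAST n. x \<in> B n)" by (rule LeastI)
      moreover have "(LEAST n. x \<in> B n) < N"
      proof (rule ccontr)
        assume "\<not> ?thesis"
        then have "w x \<le> (1 / 2) ^ N"
          using xA by (simp add: w_def power_decreasing)
        then show False using N x by simp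
      qed
      ultimately show ?thesis by blast
    qed
    then show "\<exists>A\<in>insert {} \<L>. \<forall>x. \<epsilon> \<le> w x \<longrightarrow> x \<in> A"
      using Un by blast
  qed
  then show ?thesis by (intro exI[of _ w]) (auto simp: w_def)
qed

section \<open>Separation and completeness of the function space\<close>

lemma tychonoff_cfun_topology:
  assumes \<L>: "bornology (topspace X) \<L>"
  shows "tychonoff_space (cfun_topology X \<L> m)"
proof (rule tychonoff_space_pseudometrics, unfold compatible_cfun_uniformity(1)[OF \<L>])
  let ?C = "cfuns X (mtopology_of m)"
  fix W f assume W: "openin (cfun_topology X \<L> m) W" "f \<in> W"
  obtain A \<epsilon> where A: "A \<in> insert {} \<L>" "\<epsilon> > 0"
    and AW: "\<And>g. g \<in> ?C \<Longrightarrow> \<forall>x\<in>A. mdist m (f x) (g x) < \<epsilon> \<Longrightarrow> g \<in> W"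
    using cfun_topology_neighbourhood[OF \<L> W] by blast
  note w = vanishing_weight_indicator[OF A(1)]
  \<comment> \<open>A radius of at most 1 ensures that the bound falls on the distance and not on
    the truncation by the indicator.\<close>
  have "g \<in> W" if "g \<in> ?C" "weighted_dist m (indicator A) f g < min 1 \<epsilon>" for g
  proof (rule AW[OF that(1)], rule ballI)
    fix x assume "x \<in> A"
    then show "mdist m (f x) (g x) < \<epsilon>"
      using weighted_dist_upper[OF w, of x m f g] that(2) by auto
  qed
  then show "\<exists>d \<epsilon>. continuous_pseudometric (cfun_topology X \<L> m) d \<and> 0 < \<epsilon> \<and>
      (\<forall>g\<in>?C. d f g < \<epsilon> \<longrightarrow> g \<in> W)"
    using continuous_pseudometric_weighted_dist[OF \<L> w] A(2)
    by (intro exI[of _ "weighted_dist m (indicator A)"] exI[of _ "min 1 \<epsilon>"]) auto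
next
  let ?C = "cfuns X (mtopology_of m)"
  fix f g assume fg: "f \<in> ?C" "g \<in> ?C" "f \<noteq> g"
  \<comment> \<open>Extensionality excludes functions that differ only outside the space.\<close>
  then obtain x where x: "x \<in> topspace X" "f x \<noteq> g x"
    unfolding cfuns_def by (auto intro: extensionalityI)
  then obtain A where A: "A \<in> \<L>" "x \<in> A"
    using \<L> unfolding bornology_def by blast
  then have w: "vanishing_weight \<L> (indicator A)"
    by (intro vanishing_weight_indicator) auto
  have "mdist m (f x) (g x) > 0"
    using x(2) cfuns_mspace[OF fg(1) x(1)] cfuns_mspace[OF fg(2) x(1)]
    by (simp add: order_less_le)
  then have "weighted_dist m (indicator A) f g > 0"
    using weighted_dist_upper[OF w, of x m f g] A(2) by (auto simp: min_def split: if_splits)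
  then show "\<exists>d. continuous_pseudometric (cfun_topology X \<L> m) d \<and> 0 < d f g"
    using continuous_pseudometric_weighted_dist[OF \<L> w] by blast
qed

text \<open>The weighted pseudometric gives \<open>F\<close> a limit \<open>g\<close>, depending on
  \<open>w\<close>, inside the function space, so \<open>g\<close> is continuous. Where the weight
  is positive, convergence for that pseudometric forces pointwise convergence.\<close>

lemma Cauchy_filter_cfun_limit_on:
  assumes \<L>: "bornology (topspace X) \<L>" and w: "vanishing_weight \<L> w"
    and U: "finest_uniformity (cfun_topology X \<L> m) U"
    and F: "F \<noteq> bot" "F \<le> principal (cfuns X (mtopology_of m))" "F \<times>\<^sub>F F \<le> U"
  shows "\<exists>g\<in>cfuns X (mtopology_of m). \<forall>x. w x > 0 \<longrightarrow> ((\<lambda>h. mdist m (g x) (h x)) \<longlongrightarrow> 0) F"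
proof -
  obtain g where g: "g \<in> cfuns X (mtopology_of m)" "((\<lambda>h. weighted_dist m w g h) \<longlongrightarrow> 0) F"
    using Cauchy_filter_pseudometric_limit[OF U continuous_pseudometric_weighted_dist[OF \<L> w] F(1) _ F(3)]
      F(2) compatible_cfun_uniformity(1)[OF \<L>, of m] by auto
  have "((\<lambda>h. mdist m (g x) (h x)) \<longlongrightarrow> 0) F" if "w x > 0" for x
  proof (rule tendstoI)
    fix \<epsilon> :: real assume "\<epsilon> > 0"
    \<comment> \<open>A value below \<open>w x\<close> means that the minimum at \<open>x\<close> is
      the distance itself.\<close>
    then have "eventually (\<lambda>h. weighted_dist m w g h < min \<epsilon> (w x)) F"
      using g(2) that by (intro order_tendstoD) auto
    then show "eventually (\<lambda>h. dist (mdist m (g x) (h x)) 0 < \<epsilon>) F"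
    proof eventually_elim
      case (elim h)
      then show ?case
        using weighted_dist_upper[OF w, of x m g h] by (auto simp: min_def split: if_splits)
    qed
  qed
  then show ?thesis using g(1) by blast
qed

text \<open>Serves to identify the continuous limits obtained from different weights with one
  pointwise limit.\<close>

lemma mdist_limit_unique:
  assumes "F \<noteq> bot" "F \<le> principal {h. h x \<in> mspace m}" "a \<in> mspace m" "b \<in> mspace m"
    and "((\<lambda>h. mdist m a (h x)) \<longlongrightarrow> 0) F" "((\<lambda>h. mdist m b (h x)) \<longlongrightarrow> 0) F"
  shows "a = b"
proof -
  have "mdist m a b \<le> 0 + 0"
  proof (rule tendsto_lowerbound)
    show "((\<lambda>h. mdist m a (h x) + mdist m b (h x)) \<longlongrightarrow> 0 + 0) F"
      by (rule tendsto_add) (fact assms)+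
    have "eventually (\<lambda>h. h x \<in> mspace m) F"
      using assms(2) by (simp add: le_principal)
    then show "eventually (\<lambda>h. mdist m a b \<le> mdist m a (h x) + mdist m b (h x)) F"
    proof eventually_elim
      case (elim h)
      then show ?case
        using mdist_triangle[OF assms(3) elim assms(4)] by (simp add: mdist_commute)
    qed
  qed (fact assms(1))
  then show ?thesis
    using assms(3,4) mdist_nonneg[of m a b] by simp
qed

lemma complete_structure_cfun:
  assumes \<L>: "bornology (topspace X) \<L>"
    and fg: "functionally_generated X (countable_unions \<L>) (mtopology_of m)"
    and U: "finest_uniformity (cfun_topology X \<L> m) U"
  shows "complete_structure_on (cfuns X (mtopology_of m)) U"
  unfolding complete_structure_on_def
proof (intro allI impI, elim conjE)
  let ?C = "cfuns X (mtopology_of m)" and ?T = "cfun_topology X \<L> m"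
  fix F assume F: "F \<noteq> bot" "F \<le> principal ?C" "F \<times>\<^sub>F F \<le> U"
  note top = compatible_cfun_uniformity(1)[OF \<L>, of m]
  note lim_on = Cauchy_filter_cfun_limit_on[OF \<L> _ U F]
  have FC: "eventually (\<lambda>h. h \<in> ?C) F"
    using F(2) by (simp add: le_principal)
  have Fx: "F \<le> principal {h. h x \<in> mspace m}" if "x \<in> topspace X" for x
    unfolding le_principal using FC cfuns_mspace[OF _ that] by (auto elim!: eventually_mono)
  \<comment> \<open>Some member of \<open>\<L>\<close> contains \<open>x\<close>, and its indicator
    is a weight positive at \<open>x\<close>. Only the value at \<open>x\<close> of the resulting
    limit is kept.\<close>
  have "\<exists>y\<in>mspace m. ((\<lambda>h. mdist m y (h x)) \<longlongrightarrow> 0) F" if x: "x \<in> topspace X" for x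
  proof -
    obtain A where A: "A \<in> \<L>" "x \<in> A"
      using \<L> x unfolding bornology_def by blast
    obtain g where "g \<in> ?C" "((\<lambda>h. mdist m (g x) (h x)) \<longlongrightarrow> 0) F"
      using lim_on[OF vanishing_weight_indicator[of A]] A by (auto simp: indicator_def)
    then show ?thesis using cfuns_mspace[OF _ x] by blast
  qed
  then obtain f' where f': "\<And>x. x \<in> topspace X \<Longrightarrow> f' x \<in> mspace m"
    "\<And>x. x \<in> topspace X \<Longrightarrow> ((\<lambda>h. mdist m (f' x) (h x)) \<longlongrightarrow> 0) F"
    by metis
  \<comment> \<open>Restriction makes the pointwise limit extensional, as membership in
    \<open>cfuns\<close> requires.\<close>
  define f where "f = restrict f' (topspace X)"
  have f: "f x \<in> mspace m" "((\<lambda>h. mdist m (f x) (h x)) \<longlongrightarrow> 0) F" if "x \<in> topspace X" for x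
    using f' that by (auto simp: f_def)
  have "continuous_map X (mtopology_of m) f"
  proof (rule ccontr)
    assume "\<not> ?thesis"
    then obtain A where A: "A \<in> countable_unions \<L>"
      and noext: "\<And>g. continuous_map X (mtopology_of m) g \<Longrightarrow> \<not> (\<forall>x\<in>A. g x = f x)"
      using fg f(1) unfolding functionally_generated_def by (metis (no_types, lifting) Pi_I topspace_mtopology_of)
    \<comment> \<open>One weight positive on all of \<open>A\<close> yields one continuous
      \<open>g\<close> for the whole countable union; it agrees with \<open>f\<close> there, against
      \<open>noext\<close>.\<close>
    obtain w where w: "vanishing_weight \<L> w" "\<forall>x\<in>A. w x > 0"
      using vanishing_weight_countable_union[OF \<L> A] by blast
    obtain g where g: "g \<in> ?C" "\<And>x. w x > 0 \<Longrightarrow> ((\<lambda>h. mdist m (g x) (h x)) \<longlongrightarrow> 0) F"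
      using lim_on[OF w(1)] by blast
    have "g x = f x" if "x \<in> A" for x
    proof -
      have wx: "w x > 0" using w(2) that by blast
      then have x: "x \<in> topspace X" by (rule vanishing_weight_support[OF \<L> w(1)])
      show ?thesis
        using mdist_limit_unique[OF F(1) Fx[OF x] cfuns_mspace[OF g(1) x] f(1)[OF x] g(2)[OF wx] f(2)[OF x]] .
    qed
    then show False using noext g(1) by (auto simp: cfuns_def)
  qed
  then have fC: "f \<in> ?C" by (simp add: cfuns_def f_def)
  \<comment> \<open>The uniformity of the function space is among the compatible ones, so
    \<open>F\<close> is Cauchy for uniform convergence on members of \<open>\<L>\<close>.\<close>
  have "U \<le> cfun_uniformity X \<L> m"
    using U compatible_cfun_uniformity(2)[OF \<L>] unfolding finest_uniformity_def by blast
  with F(3) have FU: "F \<times>\<^sub>F F \<le> cfun_uniformity X \<L> m" by simp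
  have "limitin ?T (\<lambda>y. y) f F"
    unfolding limitin_def top
  proof (intro conjI fC allI impI, elim conjE)
    fix W assume W: "openin ?T W" "f \<in> W"
    obtain A \<epsilon> where A: "A \<in> insert {} \<L>" "\<epsilon> > 0"
      and AW: "\<And>g. g \<in> ?C \<Longrightarrow> \<forall>x\<in>A. mdist m (f x) (g x) < \<epsilon> \<Longrightarrow> g \<in> W"
      using cfun_topology_neighbourhood[OF \<L> W] by blast
    have "eventually (\<lambda>(g, h). \<forall>x\<in>A. mdist m (g x) (h x) < \<epsilon> / 2) (cfun_uniformity X \<L> m)"
      unfolding eventually_cfun_uniformity'[OF \<L>]
      using A by (intro bexI[of _ A] exI[of _ "\<epsilon> / 2"]) auto
    then have "eventually (\<lambda>(g, h). \<forall>x\<in>A. mdist m (g x) (h x) < \<epsilon> / 2) (F \<times>\<^sub>F F)"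
      using FU by (rule filter_leD[rotated])
    then obtain P where P: "eventually P F"
      "\<And>g h x. P g \<Longrightarrow> P h \<Longrightarrow> x \<in> A \<Longrightarrow> mdist m (g x) (h x) < \<epsilon> / 2"
      unfolding eventually_prod_same by auto
    \<comment> \<open>The uniform Cauchy bound passes to the pointwise limit: the auxiliary
      \<open>g\<close> below may depend on \<open>x\<close>, while \<open>P\<close> and the final
      bound do not.\<close>
    have "h \<in> W" if h: "P h" "h \<in> ?C" for h
    proof (rule AW[OF h(2)], rule ballI)
      fix x assume x: "x \<in> A"
      then have xX: "x \<in> topspace X" using A(1) \<L> unfolding bornology_def by blast
      have "eventually (\<lambda>g. mdist m (f x) (g x) < \<epsilon> / 2) F"
        using f(2)[OF xX] A(2) by (intro order_tendstoD) auto
      then have "eventually (\<lambda>g. mdist m (f x) (g x) < \<epsilon> / 2 \<and> P g \<and> g \<in> ?C) F"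
        using P(1) FC by (intro eventually_conj)
      then obtain g where g: "mdist m (f x) (g x) < \<epsilon> / 2" "P g" "g \<in> ?C"
        using eventually_happens'[OF F(1)] by blast
      have "mdist m (f x) (h x) \<le> mdist m (f x) (g x) + mdist m (g x) (h x)"
        by (intro mdist_triangle cfuns_mspace[OF _ xX] fC g h)
      then show "mdist m (f x) (h x) < \<epsilon>"
        using g(1) P(2)[OF g(2) h(1) x] by linarith
    qed
    with P(1) FC show "eventually (\<lambda>h. h \<in> W) F"
      by (auto elim: eventually_elim2)
  qed
  moreover have "uniform_topology ?C U = ?T"
    using U top by (auto simp: finest_uniformity_def compatible_uniformity_def)
  ultimately show "\<exists>f\<in>?C. limitin (uniform_topology ?C U) (\<lambda>y. y) f F"
    using fC by auto
qed

theorem theorem3p4: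
  fixes X :: "'a topology" and \<L> \<B> :: "'a set set" and m :: "'b metric"
  assumes "tychonoff_space X"
    and "bornology (topspace X) \<L>"
    and "bornology_base \<L> \<B>" and "\<forall>B\<in>\<B>. closedin X B"
    and "functionally_generated X (countable_unions \<L>) (mtopology_of m)"
  shows "Dieudonne_complete (cfun_topology X \<L> m)"
proof -
  \<comment> \<open>\<open>cfun_uniformity\<close> witnesses that compatible uniformities exist, so
    there is a finest one; completeness has been shown for any such \<open>U\<close>.\<close>
  obtain U where "finest_uniformity (cfun_topology X \<L> m) U"
    using finest_uniformity_exists[OF compatible_cfun_uniformity(2)[OF assms(2)]] by blast
  then show ?thesis
    using complete_structure_cfun[OF assms(2,5)] tychonoff_cfun_topology[OF assms(2)]
      compatible_cfun_uniformity(1)[OF assms(2), of m]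
    unfolding Dieudonne_complete_def by metis
qed

end
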